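(* Let $n,m\in\mathbb{N}$, and let $\Phi$ be a frame for $\mathbb{K}^n$ with $m$ frame vectors and singular values $(\sigma_i)_{i=1}^n$. Suppose that $r\le m-n$ and that $I_r\subset\{1,\dots,n\}$ with $|I_r|=r$. Then, for any sequence $(q_i)_{i\in I_r}$ satisfying $q_i\ge 1/\sigma_i$ for all $i\in I_r$, there exists a dual frame $\Psi$ of $\Phi$ such that $\{q_i\}_{i\in I_r}$ is contained in the spectrum of $\Psi$. Furthermore, it (the dual frame $\Psi$) can be found constructively using a sequence of orthogonalization procedures.
   Context: $\mathbb{K}$ denotes $\mathbb{R}$ or $\mathbb{C}$. A frame for $\mathbb{K}^n$ with $m$ frame vectors is a family $(\phi_i)_{i=1}^m$ in $\mathbb{K}^n$ for which there are constants $0<A\le B$ with $A\|x\|_2^2\le\sum_{i=1}^m|\langle x,\phi_i\rangle|^2\le B\|x\|_2^2$ for all $x\in\mathbb{K}^n$; it is identified with the $n\times m$ matrix $\Phi$ whose columns are the $\phi_i$. The singular values of a frame are those of its matrix, in non-increasing order $\sigma_1\ge\dots\ge\sigma_n>0$; the spectrum of a frame $\Psi$ refers to the singular values of its $n\times m$ matrix. A dual frame of $\Phi$ is a frame $\Psi=(\psi_i)_{i=1}^m$ for $\mathbb{K}^n$ with $x=\sum_{i=1}^m\langle x,\phi_i\rangle\psi_i$ for all $x\in\mathbb{K}^n$, equivalently $\Psi\Phi^*=I_n$, where $I_n$ is the $n\times n$ identity matrix. For the constructive part: if $\Phi=U\Sigma_\Phi V^*$ is a full singular value decomposition, the duals of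 $\Phi$ are exactly the matrices $UMV^*$, where the $i$-th row of $M\in\mathbb{K}^{n\times m}$ has $1/\sigma_i$ in position $i$, zeros in the other first $n$ positions, and an arbitrary vector $s_i\in\mathbb{K}^{m-n}$ in the last $m-n$ positions; the orthogonalization concerns choosing the vectors $s_i$, $i\in I_r$, mutually orthogonal with $q_i^2=1/\sigma_i^2+\|s_i\|_2^2$, and $s_i=0$ for $i\notin I_r$. *)

theory Defs
  imports
    "HOL-Analysis.L2_Norm"
    "Jordan_Normal_Form.Schur_Decomposition"
begin

section \<open>The scalar field\<close>

text \<open>
  A type of this class is (isomorphic to) the real or the complex numbers, and the norm axiom forces
  \<^term>\<open>conjugate\<close> to be the usual conjugation.  The partial order inherited from
  \<^class>\<open>conjugatable_ordered_field\<close> plays no role below.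
\<close>

class real_or_complex = conjugatable_ordered_field + real_normed_field +
  assumes real_or_complex:
      "(\<forall>x. \<exists>a. x = a *\<^sub>R 1) \<or>
       (\<exists>j. j * j = - 1 \<and> (\<forall>x. \<exists>a b. x = a *\<^sub>R 1 + b *\<^sub>R j))"
    and conjugate_mult_self: "conjugate x * x = (norm x)\<^sup>2 *\<^sub>R 1"

instance real :: real_or_complex
  by intro_classes (auto simp: power2_eq_square)

instance complex :: real_or_complex
proof
  have "\<i> * \<i> = (- 1 :: complex) \<and> (\<forall>x. \<exists>a b. x = a *\<^sub>R 1 + b *\<^sub>R \<i>)"
    by (auto simp: complex_eq_iff)
  then show "(\<forall>x::complex. \<exists>a. x = a *\<^sub>R 1) \<or>
      (\<exists>j::complex. j * j = - 1 \<and> (\<forall>x. \<exists>a b. x = a *\<^sub>R 1 + b *\<^sub>R j))"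
    by blast
next
  fix x :: complex
  show "conjugate x * x = (norm x)\<^sup>2 *\<^sub>R 1"
    by (simp add: complex_eq_iff cmod_power2) (simp add: power2_eq_square)
qed

section \<open>Frames and dual frames\<close>

definition l2_norm :: "'a::real_or_complex vec \<Rightarrow> real" where
  "l2_norm x = L2_set (\<lambda>i. norm (x $ i)) {..<dim_vec x}"

text \<open>
  A family of \<open>m\<close> vectors in \<open>K\<^sup>n\<close> is identified with the \<open>n \<times> m\<close> matrix whose columns they are; the
  indices run from \<open>0\<close>.  The inner product \<open>x \<bullet>c y\<close> is linear in \<open>x\<close> and conjugate linear in \<open>y\<close>.
\<close>

definition is_frame :: "nat \<Rightarrow> nat \<Rightarrow> 'a::real_or_complex mat \<Rightarrow> bool" where
  "is_frame n m \<Phi> \<longleftrightarrow> \<Phi> \<in> carrier_mat n m \<and>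
     (\<exists>A B. 0 < A \<and> A \<le> B \<and>
       (\<forall>x \<in> carrier_vec n.
          A * (l2_norm x)\<^sup>2 \<le> (\<Sum>i<m. (norm (x \<bullet>c col \<Phi> i))\<^sup>2) \<and>
          (\<Sum>i<m. (norm (x \<bullet>c col \<Phi> i))\<^sup>2) \<le> B * (l2_norm x)\<^sup>2))"

definition is_dual_frame ::
  "nat \<Rightarrow> nat \<Rightarrow> 'a::real_or_complex mat \<Rightarrow> 'a mat \<Rightarrow> bool" where
  "is_dual_frame n m \<Phi> \<Psi> \<longleftrightarrow> is_frame n m \<Psi> \<and>
     (\<forall>x \<in> carrier_vec n.
        x = finsum_vec TYPE('a) n (\<lambda>i. (x \<bullet>c col \<Phi> i) \<cdot>\<^sub>v col \<Psi> i) {..<m})"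

section \<open>Singular values\<close>

text \<open>
  The square roots of the eigenvalues of the smaller of the two Gram matrices \<open>A A\<^sup>*\<close>, \<open>A\<^sup>* A\<close>, with
  multiplicity, in non-increasing order.  The eigenvalues are nonnegative reals embedded in \<^typ>\<open>'a\<close>,
  so \<^term>\<open>norm\<close> merely reads them off as real numbers.
\<close>

definition singular_values :: "'a::real_or_complex mat \<Rightarrow> real list" where
  "singular_values A =
     (let G = (if dim_row A \<le> dim_col A then A * mat_adjoint A else mat_adjoint A * A)
      in rev (sorted_list_of_multiset
           (image_mset (\<lambda>x. sqrt (norm x)) (proots (char_poly G)))))"

definition unitary_mat :: "nat \<Rightarrow> 'a::real_or_complex mat \<Rightarrow> bool" where
  "unitary_mat n U \<longleftrightarrow> U \<in> carrier_mat n n \<and> U * mat_adjoint U = 1\<^sub>m n \<and> mat_adjoint U * U = 1\<^sub>m n"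

definition is_full_svd ::
  "nat \<Rightarrow> nat \<Rightarrow> 'a::real_or_complex mat \<Rightarrow> 'a mat \<Rightarrow> 'a mat \<Rightarrow> bool" where
  "is_full_svd n m \<Phi> U V \<longleftrightarrow> unitary_mat n U \<and> unitary_mat m V \<and>
     \<Phi> = U * mat n m (\<lambda>(i, j). if i = j then of_real (singular_values \<Phi> ! i) else 0)
           * mat_adjoint V"

section \<open>Duals from orthogonalization\<close>

text \<open>The matrix \<open>M\<close> whose \<open>i\<close>-th row is \<open>(0, \<dots>, 1/\<sigma>\<^sub>i, \<dots>, 0, s\<^sub>i)\<close>.\<close>

definition dual_core ::
  "nat \<Rightarrow> nat \<Rightarrow> real list \<Rightarrow> (nat \<Rightarrow> 'a::real_or_complex vec) \<Rightarrow> 'a mat" where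
  "dual_core n m \<sigma> s = mat n m (\<lambda>(i, j).
     if j < n then (if i = j then of_real (1 / \<sigma> ! i) else 0) else s i $ (j - n))"

text \<open>
  The family \<open>(s\<^sub>i)\<close> is produced as follows: enumerate \<open>I\<close> as \<open>js\<close>, run Gram-Schmidt on
  linearly independent vectors \<open>ws\<close> of \<open>K\<^sup>k\<close>, one for each index in \<open>js\<close>, and rescale the vector
  belonging to \<open>i\<close> to the length \<open>sqrt (q\<^sub>i\<^sup>2 - 1/\<sigma>\<^sub>i\<^sup>2)\<close>; the vectors with \<open>i \<notin> I\<close> are zero.
  The starting vectors and the enumeration are arbitrary.
\<close>

definition orthogonalized_family ::
  "nat \<Rightarrow> real list \<Rightarrow> (nat \<Rightarrow> real) \<Rightarrow> nat set \<Rightarrow> (nat \<Rightarrow> 'a::real_or_complex vec) \<Rightarrow> bool" where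
  "orthogonalized_family k \<sigma> q I s \<longleftrightarrow>
     (\<exists>js ws. distinct js \<and> set js = I \<and> length ws = length js \<and>
        set ws \<subseteq> carrier_vec k \<and> distinct ws \<and>
        \<not> module.lin_dep class_ring (module_vec TYPE('a) k) (set ws) \<and>
        (\<forall>l < length js.
           let i = js ! l; u = gram_schmidt k ws ! l
           in s i = of_real (sqrt ((q i)\<^sup>2 - 1 / (\<sigma> ! i)\<^sup>2) / l2_norm u) \<cdot>\<^sub>v u) \<and>
        (\<forall>i. i \<notin> I \<longrightarrow> s i = 0\<^sub>v k))"

end

theory Submission
  imports Defs
begin

text \<open>
  Since \<open>\<Phi>\<Phi>\<^sup>*\<close> is Hermitian and positive definite, it has an orthonormal eigenbasis \<open>u\<^sub>i\<close>; the
  vectors \<open>\<Phi>\<^sup>* u\<^sub>i / \<sigma>\<^sub>i\<close> are orthonormal, and completing them to a basis of \<open>K\<^sup>m\<close> gives a full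
  singular value decomposition \<open>\<Phi> = U \<Sigma> V\<^sup>*\<close>.  For any choice of the \<open>s\<^sub>i\<close>, \<open>\<Psi> = U M V\<^sup>*\<close> satisfies
  \<open>\<Psi>\<Phi>\<^sup>* = U M \<Sigma>\<^sup>* U\<^sup>* = I\<close>.  If the \<open>s\<^sub>i\<close> are mutually orthogonal, then \<open>M M\<^sup>*\<close> is diagonal with entries
  \<open>1/\<sigma>\<^sub>i\<^sup>2 + \<parallel>s\<^sub>i\<parallel>\<^sup>2\<close>, so the square roots of these numbers are the singular values of \<open>\<Psi>\<close>.  There is
  room for \<open>r\<close> nonzero orthogonal vectors because \<open>r \<le> m - n\<close>.
\<close>

section \<open>Adjoints, norms and frame bounds\<close>

text \<open>The norm axiom determines conjugation only through the product
  \<open>conjugate x * x\<close>; for a nonzero real scalar that product is its square, and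
  cancelling gives the claim.\<close>

lemma conjugate_of_real [simp]: "conjugate (of_real t :: 'a::real_or_complex) = of_real t"
proof (cases "t = 0")
  case False
  have "conjugate (of_real t :: 'a) * of_real t = of_real t * of_real t"
    using conjugate_mult_self[of "of_real t :: 'a"]
    by (simp add: power2_eq_square scaleR_conv_of_real)
  then show ?thesis using False by simp
qed simp

lemma conjugate_one [simp]: "conjugate (1 :: 'a::real_or_complex) = 1"
  by (metis conjugate_of_real of_real_1)

lemma mult_conjugate_self: "x * conjugate x = of_real ((norm x)\<^sup>2)" for x :: "'a::real_or_complex"
  by (metis conjugate_mult_self mult.commute of_real_def)

section \<open>Adjoint matrices and the inner product\<close>

lemma dim_mat_adjoint [simp]:
  "dim_row (mat_adjoint A) = dim_col A" "dim_col (mat_adjoint A) = dim_row A"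
  by (simp_all add: mat_adjoint_def)

lemma index_mat_adjoint [simp]:
  "i < dim_col A \<Longrightarrow> j < dim_row A \<Longrightarrow> mat_adjoint A $$ (i, j) = conjugate (A $$ (j, i))"
  by (simp add: mat_adjoint_def mat_of_rows_index)

lemma mat_adjoint_carrier [simp]:
  "A \<in> carrier_mat n m \<Longrightarrow> mat_adjoint A \<in> carrier_mat m n"
  by (intro carrier_matI) auto

lemma mat_adjoint_adjoint [simp]: "mat_adjoint (mat_adjoint A) = A"
  by (rule eq_matI) auto

lemma mat_adjoint_one [simp]: "mat_adjoint (1\<^sub>m n :: 'a::real_or_complex mat) = 1\<^sub>m n"
  by (rule eq_matI) auto

lemma mat_adjoint_mult:
  assumes "A \<in> carrier_mat n m" "B \<in> carrier_mat m k"
  shows "mat_adjoint (A * B) = mat_adjoint B * mat_adjoint A"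
proof (rule eq_matI)
  fix i j
  assume "i < dim_row (mat_adjoint B * mat_adjoint A)" "j < dim_col (mat_adjoint B * mat_adjoint A)"
  then have ij: "i < k" "j < n" using assms by auto
  have "mat_adjoint (A * B) $$ (i, j) = (\<Sum>l<m. conjugate (B $$ (l, i)) * conjugate (A $$ (j, l)))"
    using assms ij
    by (simp add: scalar_prod_def sum_conjugate conjugate_dist_mul mult.commute atLeast0LessThan)
  also have "\<dots> = (mat_adjoint B * mat_adjoint A) $$ (i, j)"
    using assms ij by (simp add: scalar_prod_def atLeast0LessThan)
  finally show "mat_adjoint (A * B) $$ (i, j) = (mat_adjoint B * mat_adjoint A) $$ (i, j)" .
qed (use assms in auto)

lemma adjoint_mult_vec_index:
  assumes "A \<in> carrier_mat n m" "x \<in> carrier_vec n" "i < m"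
  shows "(mat_adjoint A *\<^sub>v x) $ i = x \<bullet>c col A i"
  using assms by (auto simp: scalar_prod_def mult.commute intro!: sum.cong)

lemma adjoint_mult_index:
  assumes "A \<in> carrier_mat n m" "B \<in> carrier_mat n k" "i < m" "j < k"
  shows "(mat_adjoint A * B) $$ (i, j) = col B j \<bullet>c col A i"
  using assms by (auto simp: scalar_prod_def mult.commute intro!: sum.cong)

lemma cscalar_prod_adjoint:
  assumes "A \<in> carrier_mat n m" "x \<in> carrier_vec m" "y \<in> carrier_vec n"
  shows "(A *\<^sub>v x) \<bullet>c y = x \<bullet>c (mat_adjoint A *\<^sub>v y)"
proof -
  have "(A *\<^sub>v x) \<bullet>c y = (\<Sum>i<n. \<Sum>j<m. A $$ (i, j) * x $ j * conjugate (y $ i))"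
    using assms by (auto simp: scalar_prod_def sum_distrib_right atLeast0LessThan intro!: sum.cong)
  also have "\<dots> = (\<Sum>j<m. \<Sum>i<n. A $$ (i, j) * x $ j * conjugate (y $ i))"
    by (rule sum.swap)
  also have "\<dots> = x \<bullet>c (mat_adjoint A *\<^sub>v y)"
    using assms
    by (auto simp: scalar_prod_def sum_distrib_left sum_conjugate conjugate_dist_mul
        atLeast0LessThan mult_ac intro!: sum.cong)
  finally show ?thesis .
qed

lemma cscalar_prod_commute:
  fixes x y :: "'a::conjugatable_field vec"
  assumes "x \<in> carrier_vec n" "y \<in> carrier_vec n"
  shows "conjugate (x \<bullet>c y) = y \<bullet>c x"
  using assms by (auto simp: scalar_prod_def sum_conjugate conjugate_dist_mul mult.commute
      intro!: sum.cong)

section \<open>The Euclidean norm\<close>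

lemma cscalar_prod_self: "x \<bullet>c x = of_real ((l2_norm x)\<^sup>2)"
  by (simp add: scalar_prod_def l2_norm_def L2_set_def sum_nonneg atLeast0LessThan
      mult_conjugate_self)

lemma l2_norm_nonneg [simp]: "0 \<le> l2_norm x"
  by (simp add: l2_norm_def L2_set_nonneg)

lemma l2_norm_eq_0_iff:
  assumes "x \<in> carrier_vec n"
  shows "l2_norm x = 0 \<longleftrightarrow> x = 0\<^sub>v n"
  using assms by (auto simp: l2_norm_def L2_set_eq_0_iff)

lemma l2_norm_smult: "l2_norm (c \<cdot>\<^sub>v x) = norm c * l2_norm x"
  by (auto simp: l2_norm_def norm_mult L2_set_right_distrib intro!: L2_set_cong)

lemma l2_norm_power2:
  "x \<in> carrier_vec n \<Longrightarrow> (l2_norm x)\<^sup>2 = (\<Sum>i<n. (norm (x $ i))\<^sup>2)"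
  by (auto simp: l2_norm_def L2_set_def sum_nonneg)

text \<open>Cauchy-Schwarz on each row bounds the operator by the squared Frobenius norm
  \<open>?C\<close>.\<close>

lemma l2_norm_mult_mat_vec_bounded:
  assumes A: "A \<in> carrier_mat n m"
  obtains C where "0 < C" "\<And>x. x \<in> carrier_vec m \<Longrightarrow> (l2_norm (A *\<^sub>v x))\<^sup>2 \<le> C * (l2_norm x)\<^sup>2"
proof
  let ?C = "\<Sum>i<n. (l2_norm (row A i))\<^sup>2"
  \<comment> \<open>Adding 1 keeps the constant positive even for the zero matrix, so that it may
    later be inverted.\<close>
  show "0 < ?C + 1" by (smt (verit) sum_nonneg zero_le_power2)
  fix x :: "'a vec" assume x: "x \<in> carrier_vec m"
  have "norm ((A *\<^sub>v x) $ i) \<le> l2_norm (row A i) * l2_norm x" if i: "i < n" for i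
  proof -
    have "norm ((A *\<^sub>v x) $ i) \<le> (\<Sum>j<m. norm (A $$ (i, j)) * norm (x $ j))"
      using A x i by (auto simp: scalar_prod_def norm_mult atLeast0LessThan intro!: sum_norm_le)
    \<comment> \<open>The absolute values only bring the sum into the shape of
      \<open>L2_set_mult_ineq\<close>.\<close>
    also have "\<dots> = (\<Sum>j<m. \<bar>norm (A $$ (i, j))\<bar> * \<bar>norm (x $ j)\<bar>)"
      by simp
    also have "\<dots> \<le> L2_set (\<lambda>j. norm (A $$ (i, j))) {..<m} * L2_set (\<lambda>j. norm (x $ j)) {..<m}"
      by (rule L2_set_mult_ineq)
    also have "\<dots> = l2_norm (row A i) * l2_norm x"
      using A x i by (auto simp: l2_norm_def intro!: arg_cong2[where f="(*)"] L2_set_cong)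
    finally show ?thesis .
  qed
  then have "(norm ((A *\<^sub>v x) $ i))\<^sup>2 \<le> (l2_norm (row A i) * l2_norm x)\<^sup>2" if "i < n" for i
    using that by (intro power_mono) auto
  then have "(\<Sum>i<n. (norm ((A *\<^sub>v x) $ i))\<^sup>2) \<le> ?C * (l2_norm x)\<^sup>2"
    by (auto simp: sum_distrib_right power_mult_distrib intro!: sum_mono)
  moreover have "(l2_norm (A *\<^sub>v x))\<^sup>2 = (\<Sum>i<n. (norm ((A *\<^sub>v x) $ i))\<^sup>2)"
    by (rule l2_norm_power2) (use A x in auto)
  ultimately show "(l2_norm (A *\<^sub>v x))\<^sup>2 \<le> (?C + 1) * (l2_norm x)\<^sup>2"
    by (simp add: distrib_right add_increasing2)
qed

section \<open>Frame bounds and a matrix criterion for dual frames\<close>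

text \<open>The entries of \<open>mat_adjoint A *\<^sub>v x\<close> are the frame coefficients of
  \<open>x\<close>, so frame bounds are norm bounds for this analysis operator.\<close>

lemma frame_operator_sum:
  assumes "A \<in> carrier_mat n m" "x \<in> carrier_vec n"
  shows "(\<Sum>i<m. (norm (x \<bullet>c col A i))\<^sup>2) = (l2_norm (mat_adjoint A *\<^sub>v x))\<^sup>2"
proof -
  have "mat_adjoint A *\<^sub>v x \<in> carrier_vec m"
    using assms by (intro mult_mat_vec_carrier[of _ m n]) auto
  then show ?thesis
    using assms by (simp add: l2_norm_power2 adjoint_mult_vec_index del: index_mult_mat_vec)
qed

text \<open>Taking adjoints of the hypothesis shows that \<open>A\<close> is a left inverse of
  \<open>mat_adjoint B\<close>. Boundedness of \<open>A\<close> then yields the lower frame bound of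
  \<open>B\<close>, and boundedness of \<open>mat_adjoint B\<close> the upper one. The
  reconstruction formula is the hypothesis applied to \<open>x\<close> and expanded along the
  columns of \<open>B\<close>.\<close>

lemma is_dual_frameI:
  assumes A: "A \<in> carrier_mat n m" and B: "B \<in> carrier_mat n m"
    and BA: "B * mat_adjoint A = 1\<^sub>m n"
  shows "is_dual_frame n m A B"
proof -
  have AB: "A * mat_adjoint B = 1\<^sub>m n"
    using arg_cong[OF BA, of mat_adjoint] A B
    by (simp add: mat_adjoint_mult[OF B mat_adjoint_carrier[OF A]])
  obtain C1 where C1: "0 < C1"
    "\<And>x. x \<in> carrier_vec m \<Longrightarrow> (l2_norm (A *\<^sub>v x))\<^sup>2 \<le> C1 * (l2_norm x)\<^sup>2"
    using l2_norm_mult_mat_vec_bounded[OF A] by blast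
  obtain C2 where C2: "0 < C2"
    "\<And>x. x \<in> carrier_vec n \<Longrightarrow> (l2_norm (mat_adjoint B *\<^sub>v x))\<^sup>2 \<le> C2 * (l2_norm x)\<^sup>2"
    using l2_norm_mult_mat_vec_bounded[OF mat_adjoint_carrier[OF B]] by blast
  have "is_frame n m B"
    unfolding is_frame_def
  proof (intro conjI B exI ballI)
    \<comment> \<open>Writing \<open>x\<close> as \<open>A\<close> applied to
      \<open>mat_adjoint B *\<^sub>v x\<close> gives the lower constant \<open>1 / C1\<close>. The
      upper constant is \<open>C2\<close> enlarged by it, so that the two are in order without
      comparing \<open>C1\<close> and \<open>C2\<close>.\<close>
    show "0 < 1 / C1" "1 / C1 \<le> C2 + 1 / C1" using C1 C2 by auto
    fix x :: "'a vec" assume x: "x \<in> carrier_vec n"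
    have "A *\<^sub>v (mat_adjoint B *\<^sub>v x) = x"
      using assoc_mult_mat_vec[of A n m "mat_adjoint B" n x] A B x AB by simp
    moreover have "mat_adjoint B *\<^sub>v x \<in> carrier_vec m"
      using B x by (intro mult_mat_vec_carrier[of _ m n]) auto
    ultimately have "(l2_norm x)\<^sup>2 \<le> C1 * (l2_norm (mat_adjoint B *\<^sub>v x))\<^sup>2"
      using C1(2) by metis
    then show "1 / C1 * (l2_norm x)\<^sup>2 \<le> (\<Sum>i<m. (norm (x \<bullet>c col B i))\<^sup>2)"
      using C1 by (simp add: frame_operator_sum[OF B x] field_simps)
    have "0 \<le> 1 / C1 * (l2_norm x)\<^sup>2" using C1 by simp
    then show "(\<Sum>i<m. (norm (x \<bullet>c col B i))\<^sup>2) \<le> (C2 + 1 / C1) * (l2_norm x)\<^sup>2"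
      using C2(2)[OF x] by (simp add: frame_operator_sum[OF B x] distrib_right)
  qed
  moreover have "x = finsum_vec TYPE('a) n (\<lambda>i. (x \<bullet>c col A i) \<cdot>\<^sub>v col B i) {..<m}"
    if x: "x \<in> carrier_vec n" for x
  proof -
    have cl: "(\<lambda>i. (x \<bullet>c col A i) \<cdot>\<^sub>v col B i) \<in> {..<m} \<rightarrow> carrier_vec n"
      using B by auto
    have "B *\<^sub>v (mat_adjoint A *\<^sub>v x) = x"
      using assoc_mult_mat_vec[of B n m "mat_adjoint A" n x] A B x BA by simp
    moreover have "B *\<^sub>v (mat_adjoint A *\<^sub>v x) = finsum_vec TYPE('a) n (\<lambda>i. (x \<bullet>c col A i) \<cdot>\<^sub>v col B i) {..<m}"
    proof (rule eq_vecI)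
      fix j assume "j < dim_vec (finsum_vec TYPE('a) n (\<lambda>i. (x \<bullet>c col A i) \<cdot>\<^sub>v col B i) {..<m})"
      then have j: "j < n" using finsum_vec_closed[OF cl] by auto
      have "(B *\<^sub>v (mat_adjoint A *\<^sub>v x)) $ j
        = (\<Sum>i<m. B $$ (j, i) * (mat_adjoint A *\<^sub>v x) $ i)"
        using j A B x by (auto simp: scalar_prod_def atLeast0LessThan intro!: sum.cong)
      also have "\<dots> = (\<Sum>i<m. (x \<bullet>c col A i) * B $$ (j, i))"
        using A x by (intro sum.cong)
          (auto simp: adjoint_mult_vec_index mult.commute simp del: index_mult_mat_vec)
      also have "\<dots> = finsum_vec TYPE('a) n (\<lambda>i. (x \<bullet>c col A i) \<cdot>\<^sub>v col B i) {..<m} $ j"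
        using j B by (subst index_finsum_vec[OF _ j cl]) auto
      finally show "(B *\<^sub>v (mat_adjoint A *\<^sub>v x)) $ j
        = finsum_vec TYPE('a) n (\<lambda>i. (x \<bullet>c col A i) \<cdot>\<^sub>v col B i) {..<m} $ j" .
    qed (use B finsum_vec_closed[OF cl] in auto)
    ultimately show ?thesis by metis
  qed
  ultimately show ?thesis by (simp add: is_dual_frame_def)
qed

section \<open>Orthonormal vectors and unitary matrices\<close>

lemma exists_unit_vec_orthogonal:
  fixes us :: "'a::real_or_complex vec list"
  assumes len: "length us < n" and us: "set us \<subseteq> carrier_vec n"
  obtains v where "v \<in> carrier_vec n" "l2_norm v = 1" "\<And>u. u \<in> set us \<Longrightarrow> v \<bullet>c u = 0"
proof -
  \<comment> \<open>Padding with zero rows makes \<open>A\<close> singular, and \<open>A w = 0\<close> says that \<open>w\<close> is orthogonal to \<open>us\<close>.\<close>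
  define A where "A = mat n n (\<lambda>(i, j). if i < length us then conjugate (us ! i $ j) else 0)"
  have A: "A \<in> carrier_mat n n" by (simp add: A_def)
  \<comment> \<open>Row \<open>length us\<close> of \<open>A\<close> is one of the padding rows; it
    exists because \<open>length us < n\<close>.\<close>
  have "transpose_mat A *\<^sub>v unit_vec n (length us) = 0\<^sub>v n"
    using len A by (intro eq_vecI) (auto simp: A_def scalar_prod_right_unit)
  moreover have "unit_vec n (length us) \<noteq> (0\<^sub>v n :: 'a vec)"
    using len by (auto simp: vec_eq_iff unit_vec_def)
  ultimately have "det (transpose_mat A) = 0"
    using det_0_iff_vec_prod_zero_field[of "transpose_mat A" n] A
    by (metis transpose_carrier_mat unit_vec_carrier)
  then have "det A = 0" using det_transpose[OF A] by simp
  then obtain w where w: "w \<in> carrier_vec n" "w \<noteq> 0\<^sub>v n" "A *\<^sub>v w = 0\<^sub>v n"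
    using det_0_iff_vec_prod_zero_field[OF A] by auto
  have w0: "l2_norm w \<noteq> 0" using w l2_norm_eq_0_iff by blast
  have orth: "w \<bullet>c u = 0" if u: "u \<in> set us" for u
  proof -
    obtain i where i: "i < length us" "u = us ! i" using u by (auto simp: in_set_conv_nth)
    have cu: "u \<in> carrier_vec n" using u us by auto
    have "(A *\<^sub>v w) $ i = w \<bullet>c u"
      using i len w(1) cu by (auto simp: A_def scalar_prod_def mult.commute intro!: sum.cong)
    then show ?thesis using w i len by simp
  qed
  show ?thesis
  proof
    let ?v = "of_real (1 / l2_norm w) \<cdot>\<^sub>v w"
    show "?v \<in> carrier_vec n" using w by auto
    show "l2_norm ?v = 1" using w0 by (simp add: l2_norm_smult norm_divide)
    fix u assume u: "u \<in> set us"
    then have "u \<in> carrier_vec n" using us by auto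
    then show "?v \<bullet>c u = 0" using orth[OF u] w by simp
  qed
qed

lemma unitary_matI:
  assumes U: "U \<in> carrier_mat n n" and UU: "mat_adjoint U * U = 1\<^sub>m n"
  shows "unitary_mat n U"
  unfolding unitary_mat_def
  using U UU mat_mult_left_right_inverse[OF mat_adjoint_carrier[OF U] U UU] by simp

text \<open>Induction on the number of missing vectors: a unit vector orthogonal to all present ones
  is appended until there are \<open>n\<close>, and then the matrix with these columns is
  unitary.\<close>

lemma orthonormal_extend_unitary:
  fixes us :: "'a::real_or_complex vec list"
  assumes "length us \<le> n" "set us \<subseteq> carrier_vec n"
    and "\<And>i j. i < length us \<Longrightarrow> j < length us \<Longrightarrow> us ! i \<bullet>c us ! j = (if i = j then 1 else 0)"
  shows "\<exists>W. unitary_mat n W \<and> (\<forall>i < length us. col W i = us ! i)"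
  using assms
proof (induction "n - length us" arbitrary: us)
  case 0
  then have len: "length us = n" by simp
  let ?W = "mat_of_cols n us"
  have W: "?W \<in> carrier_mat n n" using len by auto
  have col: "col ?W i = us ! i" if "i < n" for i
    using that len 0 by (intro col_mat_of_cols) auto
  have "mat_adjoint ?W * ?W = 1\<^sub>m n"
  proof (rule eq_matI)
    fix i j assume "i < dim_row (1\<^sub>m n :: 'a mat)" "j < dim_col (1\<^sub>m n :: 'a mat)"
    then have ij: "i < n" "j < n" by auto
    show "(mat_adjoint ?W * ?W) $$ (i, j) = 1\<^sub>m n $$ (i, j)"
      using adjoint_mult_index[OF W W ij] ij len by (auto simp: col 0(4))
  qed (use len in auto)
  then show ?case using unitary_matI[OF W] col len by auto
next
  case (Suc k)
  then have len: "length us < n" by simp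
  obtain v where v: "v \<in> carrier_vec n" "l2_norm v = 1" "\<And>u. u \<in> set us \<Longrightarrow> v \<bullet>c u = 0"
    using exists_unit_vec_orthogonal[OF len Suc(4)] by metis
  have vu: "u \<bullet>c v = 0" if "u \<in> set us" for u
    using that v Suc(4) cscalar_prod_commute[of v n u] by auto
  have vv: "v \<bullet>c v = 1" using v by (simp add: cscalar_prod_self)
  have "\<exists>W. unitary_mat n W \<and> (\<forall>i < length (us @ [v]). col W i = (us @ [v]) ! i)"
  proof (rule Suc(1))
    show "k = n - length (us @ [v])" using Suc(2) by simp
    show "length (us @ [v]) \<le> n" using len by simp
    show "set (us @ [v]) \<subseteq> carrier_vec n" using v Suc(4) by simp
    fix i j assume "i < length (us @ [v])" "j < length (us @ [v])"
    then show "(us @ [v]) ! i \<bullet>c (us @ [v]) ! j = (if i = j then 1 else 0)"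
      using Suc(5) v(3) vu vv by (auto simp: nth_append less_Suc_eq)
  qed
  then obtain W where W: "unitary_mat n W" "\<forall>i < length (us @ [v]). col W i = (us @ [v]) ! i" by blast
  have "col W i = us ! i" if "i < length us" for i
    using W(2) that by (auto simp: nth_append)
  then show ?case using W(1) by blast
qed

lemma unitary_mat_carrier: "unitary_mat n U \<Longrightarrow> U \<in> carrier_mat n n"
  by (simp add: unitary_mat_def)

lemma unitary_mat_mult:
  assumes "unitary_mat n U" "unitary_mat n V"
  shows "unitary_mat n (U * V)"
proof (rule unitary_matI)
  have c: "U \<in> carrier_mat n n" "V \<in> carrier_mat n n" using assms by (auto simp: unitary_mat_def)
  note c' = c[THEN mat_adjoint_carrier]
  show "U * V \<in> carrier_mat n n" using c by simp
  have "mat_adjoint (U * V) * (U * V) = mat_adjoint V * (mat_adjoint U * U) * V"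
    using c c'
    by (simp add: mat_adjoint_mult[OF c] assoc_mult_mat[of _ n n _ n _ n] mult_carrier_mat[of _ n n])
  also have "\<dots> = 1\<^sub>m n" using assms by (simp add: unitary_mat_def right_mult_one_mat[OF c'(2)])
  finally show "mat_adjoint (U * V) * (U * V) = 1\<^sub>m n" .
qed

section \<open>The spectral theorem\<close>

text \<open>The scalar type need not be algebraically closed. An embedding into the complex numbers
  that respects conjugation allows the roots of a characteristic polynomial to be found there and
  brought back.\<close>

lemma real_or_complex_embedding:
  obtains \<phi> :: "'a::real_or_complex \<Rightarrow> complex" where "inj_comm_ring_hom \<phi>"
    "\<And>x. \<phi> (conjugate x) = cnj (\<phi> x)" "\<And>t. \<phi> (of_real t) = of_real t"
proof -
  consider "\<forall>x::'a. \<exists>a. x = of_real a"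
    | j :: 'a where "j * j = - 1" "\<forall>x. \<exists>a b. x = of_real a + of_real b * j"
    using real_or_complex[where 'a='a] by (auto simp: of_real_def)
  then show ?thesis
  proof cases
    case 1
    then obtain f where f: "x = of_real (f x)" for x :: 'a by metis
    then have f_of_real: "f (of_real t) = t" for t by (metis of_real_eq_iff)
    show ?thesis
    proof
      show "inj_comm_ring_hom (\<lambda>x. complex_of_real (f x))"
      proof
        show "complex_of_real (f (x + y)) = complex_of_real (f x) + complex_of_real (f y)" for x y
          by (metis f f_of_real of_real_add)
        show "complex_of_real (f (x * y)) = complex_of_real (f x) * complex_of_real (f y)" for x y
          by (metis f f_of_real of_real_mult)
        show "complex_of_real (f 0) = 0" by (metis f_of_real of_real_0)
        show "complex_of_real (f 1) = 1" by (metis f_of_real of_real_1)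
        show "complex_of_real (f x) = 0 \<Longrightarrow> x = 0" for x by (metis f of_real_0 of_real_eq_0_iff)
      qed
      show "complex_of_real (f (conjugate x)) = cnj (complex_of_real (f x))" for x
        by (metis complex_cnj_complex_of_real conjugate_of_real f)
      show "complex_of_real (f (of_real t)) = complex_of_real t" for t
        by (simp add: f_of_real)
    qed
  next
    case 2
    note jj = 2(1)
    from 2(2) obtain f g where fg: "x = of_real (f x) + of_real (g x) * j" for x :: 'a by metis
    \<comment> \<open>Equal representations give a real number equal to a real multiple of
      \<open>j\<close>; squaring turns this into a vanishing sum of two real squares.\<close>
    have uniq: "a = c \<and> b = d"
      if eq: "of_real a + of_real b * j = of_real c + of_real d * j" for a b c d :: real
    proof -
      have "of_real (a - c) = of_real (d - b) * j" using eq by (simp add: algebra_simps)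
      then have "of_real (a - c) * of_real (a - c) = (of_real (d - b) * j) * (of_real (d - b) * j)"
        by metis
      also have "\<dots> = of_real (d - b) * of_real (d - b) * (j * j)"
        by (simp only: mult_ac)
      also have "\<dots> = of_real (- ((d - b) * (d - b)))" unfolding jj by simp
      finally have "(of_real ((a - c) * (a - c)) :: 'a) = of_real (- ((d - b) * (d - b)))" by simp
      then have "(a - c) * (a - c) = - ((d - b) * (d - b))" by (simp only: of_real_eq_iff)
      then have "(a - c)\<^sup>2 + (d - b)\<^sup>2 = 0" by (simp add: power2_eq_square)
      then show ?thesis by (simp add: sum_power2_eq_zero_iff)
    qed
    \<comment> \<open>By uniqueness the coordinates can be read off from any representation, so each
      homomorphism law reduces to exhibiting one.\<close>
    have val: "f x = a \<and> g x = b" if "x = of_real a + of_real b * j" for x a b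
      using uniq fg[of x] that by metis
    have j0: "j \<noteq> 0" using jj by auto
    \<comment> \<open>Since \<open>j\<close> has norm 1, both \<open>conjugate j\<close> and
      \<open>- j\<close> are inverses of \<open>j\<close>.\<close>
    have "(norm j)\<^sup>2 = 1" using arg_cong[OF jj, of norm] by (simp add: norm_mult power2_eq_square)
    then have "conjugate j * j = 1" using conjugate_mult_self[of j] by simp
    then have "conjugate j * j = (- j) * j" using jj by simp
    then have cj: "conjugate j = - j" using j0 mult_right_cancel by blast
    have add: "f (x + y) = f x + f y \<and> g (x + y) = g x + g y" for x y
    proof (rule val)
      have "x + y = (of_real (f x) + of_real (g x) * j) + (of_real (f y) + of_real (g y) * j)"
        using fg by metis
      then show "x + y = of_real (f x + f y) + of_real (g x + g y) * j"
        by (simp add: algebra_simps)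
    qed
    have mult: "f (x * y) = f x * f y - g x * g y \<and> g (x * y) = f x * g y + g x * f y" for x y
    proof (rule val)
      have "x * y = (of_real (f x) + of_real (g x) * j) * (of_real (f y) + of_real (g y) * j)"
        using fg by metis
      also have "\<dots> = of_real (f x) * of_real (f y) + of_real (g x) * of_real (g y) * (j * j)
          + (of_real (f x) * of_real (g y) + of_real (g x) * of_real (f y)) * j"
        by (simp add: algebra_simps)
      also have "\<dots> = of_real (f x * f y - g x * g y) + of_real (f x * g y + g x * f y) * j"
        unfolding jj by simp
      finally show "x * y = \<dots>" .
    qed
    have conj: "f (conjugate x) = f x \<and> g (conjugate x) = - g x" for x
    proof (rule val)
      have "conjugate x = conjugate (of_real (f x) + of_real (g x) * j)" using fg by metis
      then show "conjugate x = of_real (f x) + of_real (- g x) * j"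
        by (simp add: conjugate_dist_add conjugate_dist_mul cj)
    qed
    have real: "f (of_real t) = t \<and> g (of_real t) = 0" for t by (rule val) simp
    have zero: "f 0 = 0 \<and> g 0 = 0" using real[of 0] by simp
    have one: "f 1 = 1 \<and> g 1 = 0" using real[of 1] by simp
    show ?thesis
    proof
      show "inj_comm_ring_hom (\<lambda>x. Complex (f x) (g x))"
      proof
        fix x assume "Complex (f x) (g x) = 0"
        then have "f x = 0" "g x = 0" by (auto simp: complex_eq_iff)
        then show "x = 0" using fg[of x] by simp
      qed (auto simp: complex_eq_iff zero one add mult)
    qed (auto simp: complex_eq_iff conj real)
  qed
qed

text \<open>
  The roots of the characteristic polynomial exist in \<^typ>\<open>complex\<close> and are real there, so the
  factorization is the image of one over \<^typ>\<open>'a\<close>.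
\<close>

lemma hermitian_char_poly_splits:
  fixes A :: "'a::real_or_complex mat"
  assumes A: "A \<in> carrier_mat n n" and herm: "mat_adjoint A = A"
  shows "\<exists>ts. char_poly A = (\<Prod>t\<leftarrow>ts. [:- of_real t, 1:])"
proof -
  obtain \<phi> :: "'a \<Rightarrow> complex" where phi: "inj_comm_ring_hom \<phi>"
    and cnj: "\<And>x. \<phi> (conjugate x) = cnj (\<phi> x)" and real: "\<And>t. \<phi> (of_real t) = of_real t"
    using real_or_complex_embedding by blast
  interpret inj_comm_ring_hom \<phi> by (rule phi)
  interpret P: map_poly_inj_comm_ring_hom \<phi> ..
  define B where "B = map_mat \<phi> A"
  have B: "B \<in> carrier_mat n n" using A by (simp add: B_def)
  have "mat_adjoint B = B"
  proof (rule eq_matI)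
    fix i j assume "i < dim_row B" "j < dim_col B"
    then have ij: "i < n" "j < n" using B by auto
    have "mat_adjoint A $$ (i, j) = A $$ (i, j)" by (simp add: herm)
    then show "mat_adjoint B $$ (i, j) = B $$ (i, j)"
      using A ij by (simp add: B_def cnj[symmetric])
  qed (use B in auto)
  obtain as where as: "char_poly B = (\<Prod>a\<leftarrow>as. [:- a, 1:])"
    using char_poly_factorized[OF B] by blast
  have re: "of_real (Re a) = a" if a: "a \<in> set as" for a
  proof -
    have "poly (char_poly B) a = 0" unfolding as using a by (auto simp: poly_prod_list prod_list_zero_iff)
    then obtain v where v: "v \<in> carrier_vec n" "v \<noteq> 0\<^sub>v n" "B *\<^sub>v v = a \<cdot>\<^sub>v v"
      using eigenvalue_root_char_poly[OF B] B by (auto simp: eigenvalue_def eigenvector_def)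
    \<comment> \<open>Moving the Hermitian matrix \<open>B\<close> across the inner product
      identifies the eigenvalue with its conjugate.\<close>
    have "a * (v \<bullet>c v) = (B *\<^sub>v v) \<bullet>c v" using v by simp
    also have "\<dots> = v \<bullet>c (B *\<^sub>v v)"
      using cscalar_prod_adjoint[OF B v(1) v(1)] \<open>mat_adjoint B = B\<close> by simp
    also have "\<dots> = cnj a * (v \<bullet>c v)" using v by (simp add: conjugate_smult_vec)
    finally have "a = cnj a" using v conjugate_square_eq_0_vec[OF v(1)] by simp
    then show ?thesis by (simp add: complex_eq_iff)
  qed
  have "map_poly \<phi> (char_poly A) = (\<Prod>a\<leftarrow>as. [:- a, 1:])"
    using char_poly_hom[OF A] as by (simp add: B_def)
  also have "\<dots> = (\<Prod>a\<leftarrow>as. map_poly \<phi> [:- of_real (Re a), 1:])"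
    by (intro arg_cong[of _ _ prod_list] map_cong refl) (simp add: hom_uminus real re)
  also have "\<dots> = map_poly \<phi> (\<Prod>a\<leftarrow>as. [:- of_real (Re a), 1:])"
    by (simp add: P.hom_prod_list comp_def)
  finally have "char_poly A = (\<Prod>t\<leftarrow>map Re as. [:- of_real t, 1:])"
    by (simp add: comp_def)
  then show ?thesis by blast
qed

section \<open>Unitary diagonalization of Hermitian matrices\<close>

lemma char_poly_unitary_conj:
  assumes U: "unitary_mat n U" and A: "A \<in> carrier_mat n n"
  shows "char_poly (U * A * mat_adjoint U) = char_poly A"
proof -
  have "similar_mat (U * A * mat_adjoint U) A"
    by (rule similar_matI[of _ _ U "mat_adjoint U" n]) (use U A in \<open>auto simp: unitary_mat_def\<close>)
  then show ?thesis by (rule char_poly_similar)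
qed

lemma char_poly_mat_diag: "char_poly (mat_diag n f) = (\<Prod>i\<leftarrow>[0..<n]. [:- f i, 1:])"
proof -
  have "upper_triangular (mat_diag n f)" by (auto simp: mat_diag_def)
  moreover have "diag_mat (mat_diag n f) = map f [0..<n]"
    by (auto simp: diag_mat_def mat_diag_def)
  ultimately show ?thesis
    using char_poly_upper_triangular[of "mat_diag n f" n] by (simp add: comp_def)
qed

lemma mult_block_diagonal:
  assumes "A \<in> carrier_mat k k" "B \<in> carrier_mat k k" "C \<in> carrier_mat l l" "D \<in> carrier_mat l l"
  shows "four_block_mat A (0\<^sub>m k l) (0\<^sub>m l k) C * four_block_mat B (0\<^sub>m k l) (0\<^sub>m l k) D
    = four_block_mat (A * B) (0\<^sub>m k l) (0\<^sub>m l k) (C * D)"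
  by (subst mult_four_block_mat[of _ k k _ l _ l _ _ k _ l]) (use assms in auto)

text \<open>Induction on the list of roots. A unit eigenvector for the first root becomes the first
  column of a unitary matrix, and conjugating by it splits off that root from a smaller Hermitian
  block. The diagonal follows the given order of \<open>es\<close>, so no later permutation is
  needed.\<close>

theorem hermitian_unitary_diagonalization:
  fixes A :: "'a::real_or_complex mat"
  assumes "A \<in> carrier_mat n n" "mat_adjoint A = A" "char_poly A = (\<Prod>e\<leftarrow>es. [:- e, 1:])"
  shows "\<exists>U. unitary_mat n U \<and> A = U * mat_diag n (\<lambda>i. es ! i) * mat_adjoint U"
  using assms
proof (induction es arbitrary: n A)
  case Nil
  then have "n = 0" using degree_monic_char_poly[OF Nil(1)] by simp
  then show ?case using Nil(1) by (intro exI[of _ "1\<^sub>m n"]) (auto simp: unitary_mat_def)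
next
  case (Cons e es)
  note A = Cons(2) and herm = Cons(3)
  have "degree (char_poly A) = length (e # es)"
    unfolding Cons(4) using degree_linear_factors[of uminus "e # es"] by simp
  then obtain k where n: "n = Suc k" using degree_monic_char_poly[OF A] by auto
  have "poly (char_poly A) e = 0" unfolding Cons(4) by simp
  then obtain w where w: "w \<in> carrier_vec n" "w \<noteq> 0\<^sub>v n" "A *\<^sub>v w = e \<cdot>\<^sub>v w"
    using eigenvalue_root_char_poly[OF A] A by (auto simp: eigenvalue_def eigenvector_def)
  define v where "v = of_real (1 / l2_norm w) \<cdot>\<^sub>v w"
  have v: "v \<in> carrier_vec n" "A *\<^sub>v v = e \<cdot>\<^sub>v v"
    using w A by (auto simp: v_def mult_mat_vec smult_smult_assoc mult.commute)
  have "l2_norm v = 1" using w l2_norm_eq_0_iff[OF w(1)] by (simp add: v_def l2_norm_smult norm_divide)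
  then have vv: "v \<bullet>c v = 1" by (simp add: cscalar_prod_self)
  obtain W where W: "unitary_mat n W" "col W 0 = v"
    using orthonormal_extend_unitary[of "[v]" n] v vv n by auto
  note Wc = unitary_mat_carrier[OF W(1)]
  have WW: "mat_adjoint W * W = 1\<^sub>m n" "W * mat_adjoint W = 1\<^sub>m n"
    using W by (auto simp: unitary_mat_def)
  define B where "B = mat_adjoint W * A * W"
  have B: "B \<in> carrier_mat n n" using Wc A by (auto simp: B_def)
  have AB: "A = W * B * mat_adjoint W"
  proof -
    have "W * B * mat_adjoint W = (W * mat_adjoint W) * A * (W * mat_adjoint W)"
      unfolding B_def using A Wc mat_adjoint_carrier[OF Wc]
      by (simp add: assoc_mult_mat[of _ n n _ n _ n] mult_carrier_mat[of _ n n])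
    then show ?thesis using A by (simp add: WW)
  qed
  have hB: "mat_adjoint B = B"
    unfolding B_def using A Wc mat_adjoint_carrier[OF Wc] herm
    by (simp add: mat_adjoint_mult[of _ n n _ n] assoc_mult_mat[of _ n n _ n _ n])
  \<comment> \<open>The first column of \<open>W\<close> is an eigenvector and the columns are
    orthonormal, which leaves \<open>e\<close> as the only nonzero candidate in this column.\<close>
  have B0: "B $$ (i, 0) = (if i = 0 then e else 0)" if i: "i < n" for i
  proof -
    have "B = mat_adjoint W * (A * W)"
      unfolding B_def using A Wc mat_adjoint_carrier[OF Wc]
      by (simp add: assoc_mult_mat[of _ n n _ n _ n] mult_carrier_mat[of _ n n])
    then have "B $$ (i, 0) = col (A * W) 0 \<bullet>c col W i"
      using adjoint_mult_index[OF Wc, of "A * W" n i 0] A Wc i n by auto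
    also have "col (A * W) 0 = e \<cdot>\<^sub>v v"
      using col_mult2[OF A Wc, of 0] n v W by auto
    also have "(e \<cdot>\<^sub>v v) \<bullet>c col W i = e * (v \<bullet>c col W i)"
      using v Wc i by simp
    also have "v \<bullet>c col W i = (mat_adjoint W * W) $$ (i, 0)"
      using adjoint_mult_index[OF Wc Wc i, of 0] n W by auto
    finally show ?thesis using i n by (auto simp: WW)
  qed
  \<comment> \<open>The first row inherits its zeros from the first column by Hermitian
    symmetry.\<close>
  have B0': "B $$ (0, j) = (if j = 0 then e else 0)" if j: "j < n" for j
  proof (cases "j = 0")
    case False
    have "B $$ (0, j) = mat_adjoint B $$ (0, j)" by (simp add: hB)
    then show ?thesis using B0[OF j] B j n False by simp
  qed (use B0[OF j] in auto)
  define C where "C = mat k k (\<lambda>(i, j). B $$ (Suc i, Suc j))"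
  have C: "C \<in> carrier_mat k k" by (simp add: C_def)
  have BC: "B = four_block_mat (mat 1 1 (\<lambda>_. e)) (0\<^sub>m 1 k) (0\<^sub>m k 1) C"
    by (rule eq_matI) (use B n B0 B0' in \<open>auto simp: C_def\<close>)
  have hC: "mat_adjoint C = C"
  proof (rule eq_matI)
    fix i j assume "i < dim_row C" "j < dim_col C"
    then have ij: "i < k" "j < k" by (auto simp: C_def)
    have "B $$ (Suc i, Suc j) = mat_adjoint B $$ (Suc i, Suc j)" by (simp add: hB)
    then show "mat_adjoint C $$ (i, j) = C $$ (i, j)"
      using ij B n by (simp add: C_def)
  qed (auto simp: C_def)
  have "char_poly A = char_poly B"
    unfolding AB by (rule char_poly_unitary_conj[OF W(1) B])
  also have "\<dots> = [:- e, 1:] * char_poly C"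
    unfolding BC by (subst char_poly_four_block_zeros_col[OF _ _ C])
      (auto simp: char_poly_defs det_def sign_def)
  \<comment> \<open>The factor for \<open>e\<close> is kept as an unexpanded product so that it
    cancels on both sides.\<close>
  finally have "char_poly C = (\<Prod>e\<leftarrow>es. [:- e, 1:])"
    using Cons(4) by (simp del: mult_pCons_left)
  from Cons(1)[OF C hC this] obtain Q where Q: "unitary_mat k Q"
    "C = Q * mat_diag k (\<lambda>i. es ! i) * mat_adjoint Q" by blast
  note Qc = unitary_mat_carrier[OF Q(1)]
  \<comment> \<open>\<open>Q\<close> diagonalizes the smaller block; \<open>P\<close> extends it by
    the identity on the eigenvector already split off.\<close>
  define P where "P = four_block_mat (1\<^sub>m 1) (0\<^sub>m 1 k) (0\<^sub>m k 1) Q"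
  have Pc: "P \<in> carrier_mat n n" using Qc n by (intro carrier_matI) (auto simp: P_def)
  have aP: "mat_adjoint P = four_block_mat (1\<^sub>m 1) (0\<^sub>m 1 k) (0\<^sub>m k 1) (mat_adjoint Q)"
    by (rule eq_matI) (use Qc in \<open>auto simp: P_def\<close>)
  have D: "mat_diag n (\<lambda>i. (e # es) ! i)
      = four_block_mat (mat 1 1 (\<lambda>_. e)) (0\<^sub>m 1 k) (0\<^sub>m k 1) (mat_diag k (\<lambda>i. es ! i))"
    by (rule eq_matI) (auto simp: mat_diag_def n nth_Cons')
  have "mat_adjoint P * P = 1\<^sub>m n"
    unfolding aP unfolding P_def using Qc Q(1) n
    by (subst mult_block_diagonal) (auto simp: unitary_mat_def)
  then have P: "unitary_mat n P" by (rule unitary_matI[OF Pc])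
  have BP: "B = P * mat_diag n (\<lambda>i. (e # es) ! i) * mat_adjoint P"
    unfolding D aP BC Q(2) unfolding P_def
    using Qc mat_adjoint_carrier[OF Qc] mult_carrier_mat[OF Qc mat_diag_dim]
    by (simp add: mult_block_diagonal)
  have "A = (W * P) * mat_diag n (\<lambda>i. (e # es) ! i) * mat_adjoint (W * P)"
    unfolding AB BP mat_adjoint_mult[OF Wc Pc]
    using Wc Pc mat_adjoint_carrier[OF Wc] mat_adjoint_carrier[OF Pc] mat_diag_dim
    by (simp add: assoc_mult_mat[of _ n n _ n _ n] mult_carrier_mat[of _ n n])
  then show ?case using unitary_mat_mult[OF W(1) P] by blast
qed

section \<open>The singular value decomposition of a frame\<close>

text \<open>For \<open>n \<le> m\<close> the definition uses the Gram matrix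
  \<open>A * mat_adjoint A\<close>, whose roots are nonnegative reals, so squaring the singular
  values recovers them. This makes \<open>singular_values A\<close> usable as the ordered root list
  for the diagonalization.\<close>

lemma char_poly_gram_singular_values:
  fixes A :: "'a::real_or_complex mat"
  assumes A: "A \<in> carrier_mat n m" and nm: "n \<le> m"
  shows "char_poly (A * mat_adjoint A) = (\<Prod>t\<leftarrow>singular_values A. [:- of_real (t\<^sup>2), 1:])"
    and "length (singular_values A) = n"
    and "\<And>t. t \<in> set (singular_values A) \<Longrightarrow> 0 \<le> t"
proof -
  define G where "G = A * mat_adjoint A"
  note aA = mat_adjoint_carrier[OF A]
  have G: "G \<in> carrier_mat n n" using A aA by (simp add: G_def)
  have "mat_adjoint G = G" unfolding G_def using mat_adjoint_mult[OF A aA] by simp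
  then obtain ts where ts: "char_poly G = (\<Prod>t\<leftarrow>ts. [:- of_real t, 1:])"
    using hermitian_char_poly_splits[OF G] by blast
  have nonneg: "0 \<le> t" if t: "t \<in> set ts" for t
  proof -
    have "poly (char_poly G) (of_real t) = 0"
      unfolding ts using t by (auto simp: poly_prod_list prod_list_zero_iff)
    then obtain v where v: "v \<in> carrier_vec n" "v \<noteq> 0\<^sub>v n" "G *\<^sub>v v = of_real t \<cdot>\<^sub>v v"
      using eigenvalue_root_char_poly[OF G] G by (auto simp: eigenvalue_def eigenvector_def)
    have av: "mat_adjoint A *\<^sub>v v \<in> carrier_vec m" by (rule mult_mat_vec_carrier[OF aA v(1)])
    \<comment> \<open>The eigenvalue times the squared norm of \<open>v\<close> is the squared norm
      of \<open>mat_adjoint A *\<^sub>v v\<close>.\<close>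
    have "of_real t * (v \<bullet>c v) = (G *\<^sub>v v) \<bullet>c v" using v by simp
    also have "G *\<^sub>v v = A *\<^sub>v (mat_adjoint A *\<^sub>v v)"
      unfolding G_def by (rule assoc_mult_mat_vec[OF A aA v(1)])
    also have "\<dots> \<bullet>c v = (mat_adjoint A *\<^sub>v v) \<bullet>c (mat_adjoint A *\<^sub>v v)"
      by (rule cscalar_prod_adjoint[OF A av v(1)])
    finally have "of_real t * (of_real ((l2_norm v)\<^sup>2) :: 'a) = of_real ((l2_norm (mat_adjoint A *\<^sub>v v))\<^sup>2)"
      unfolding cscalar_prod_self .
    then have "t * (l2_norm v)\<^sup>2 = (l2_norm (mat_adjoint A *\<^sub>v v))\<^sup>2"
      by (metis of_real_eq_iff of_real_mult)
    moreover have "0 < (l2_norm v)\<^sup>2" using v l2_norm_eq_0_iff[OF v(1)] by simp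
    ultimately show ?thesis by (metis not_less zero_le_power2 mult_neg_pos)
  qed
  have "proots (char_poly G) = image_mset of_real (mset ts)"
  proof -
    have "proots (char_poly G) = (\<Sum>p\<leftarrow>map (\<lambda>t. [:- of_real t, 1:]) ts. proots p)"
      unfolding ts by (subst proots_prod_list[symmetric]) auto
    also have "\<dots> = image_mset of_real (mset ts)" by (induction ts) auto
    finally show ?thesis .
  qed
  then have sv: "mset (singular_values A) = image_mset sqrt (mset ts)"
    using A nm nonneg
    by (auto simp: singular_values_def Let_def G_def[symmetric] multiset.map_comp comp_def
        intro!: image_mset_cong)
  \<comment> \<open>The passage through multisets absorbs the difference in order between
    \<open>ts\<close> and the sorted singular values.\<close>
  have "char_poly G = (\<Prod>t\<in>#mset ts. [:- of_real t, 1:])"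
    unfolding ts by (simp flip: prod_mset_prod_list)
  also have "\<dots> = (\<Prod>t\<in>#mset (singular_values A). [:- of_real (t\<^sup>2), 1:])"
    unfolding sv using nonneg
    by (auto simp: multiset.map_comp comp_def simp flip: of_real_power
        intro!: arg_cong[of _ _ prod_mset] image_mset_cong)
  also have "\<dots> = (\<Prod>t\<leftarrow>singular_values A. [:- of_real (t\<^sup>2), 1:])"
    by (simp flip: prod_mset_prod_list)
  finally show *: "char_poly (A * mat_adjoint A) = (\<Prod>t\<leftarrow>singular_values A. [:- of_real (t\<^sup>2), 1:])"
    by (simp add: G_def)
  show "length (singular_values A) = n"
    using degree_monic_char_poly[OF G]
      degree_linear_factors[of "\<lambda>t. - of_real (t\<^sup>2) :: 'a" "singular_values A"]
    by (simp add: G_def *)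
  show "0 \<le> t" if "t \<in> set (singular_values A)" for t
  proof -
    have "t \<in># mset (singular_values A)" using that by simp
    then show ?thesis unfolding sv using nonneg by auto
  qed
qed

abbreviation sigma_mat :: "nat \<Rightarrow> nat \<Rightarrow> real list \<Rightarrow> 'a::real_or_complex mat" where
  "sigma_mat n m \<sigma> \<equiv> mat n m (\<lambda>(i, j). if i = j then of_real (\<sigma> ! i) else 0)"

section \<open>Positive singular values and existence of the decomposition\<close>

text \<open>A positive lower frame bound makes the analysis operator injective.\<close>

lemma is_frame_adjoint_nonzero:
  assumes "is_frame n m \<Phi>" "x \<in> carrier_vec n" "x \<noteq> 0\<^sub>v n"
  shows "mat_adjoint \<Phi> *\<^sub>v x \<noteq> 0\<^sub>v m"
proof
  assume *: "mat_adjoint \<Phi> *\<^sub>v x = 0\<^sub>v m"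
  obtain A where A: "0 < A" and Phi: "\<Phi> \<in> carrier_mat n m"
    and "A * (l2_norm x)\<^sup>2 \<le> (\<Sum>i<m. (norm (x \<bullet>c col \<Phi> i))\<^sup>2)"
    using assms unfolding is_frame_def by blast
  then have "A * (l2_norm x)\<^sup>2 \<le> (l2_norm (0\<^sub>v m :: 'a vec))\<^sup>2"
    using frame_operator_sum[OF Phi assms(2)] * by simp
  also have "l2_norm (0\<^sub>v m :: 'a vec) = 0" by (simp add: l2_norm_eq_0_iff[of _ m])
  finally have "l2_norm x = 0" using A by (simp add: mult_le_0_iff)
  then show False using assms l2_norm_eq_0_iff by blast
qed

text \<open>Multiplying the adjoint of the decomposition by \<open>U\<close> on the right cancels
  \<open>mat_adjoint U\<close>; the claim compares columns. It applies to an arbitrary full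
  decomposition, not only to a constructed one.\<close>

lemma adjoint_mult_sigma:
  assumes \<Phi>: "\<Phi> \<in> carrier_mat n m" and nm: "n \<le> m"
    and svd: "is_full_svd n m \<Phi> U V" and i: "i < n"
  shows "mat_adjoint \<Phi> *\<^sub>v col U i = of_real (singular_values \<Phi> ! i) \<cdot>\<^sub>v col V i"
proof -
  let ?S = "sigma_mat n m (singular_values \<Phi>) :: 'a mat"
  have S: "?S \<in> carrier_mat n m" by simp
  have U: "U \<in> carrier_mat n n" "mat_adjoint U * U = 1\<^sub>m n"
    and V: "V \<in> carrier_mat m m" and eq: "\<Phi> = U * ?S * mat_adjoint V"
    using svd by (auto simp: is_full_svd_def unitary_mat_def)
  note aS = mat_adjoint_carrier[OF S] and aU = mat_adjoint_carrier[OF U(1)]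
  have "mat_adjoint \<Phi> = V * (mat_adjoint ?S * mat_adjoint U)"
    using mat_adjoint_mult[of "U * ?S" n m "mat_adjoint V" m] mat_adjoint_mult[OF U(1) S] U S V eq
    by simp
  then have "mat_adjoint \<Phi> * U = V * (mat_adjoint ?S * (mat_adjoint U * U))"
    using assoc_mult_mat[OF V mult_carrier_mat[OF aS aU] U(1)] assoc_mult_mat[OF aS aU U(1)] by simp
  also have "\<dots> = V * mat_adjoint ?S" using U right_mult_one_mat[OF aS] by simp
  finally have *: "mat_adjoint \<Phi> * U = V * mat_adjoint ?S" .
  have "mat_adjoint \<Phi> *\<^sub>v col U i = col (mat_adjoint \<Phi> * U) i"
    using col_mult2[OF mat_adjoint_carrier[OF \<Phi>] U(1) i] by simp
  also have "\<dots> = V *\<^sub>v col (mat_adjoint ?S) i"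
    unfolding * using col_mult2[OF V aS i] .
  also have "col (mat_adjoint ?S) i = of_real (singular_values \<Phi> ! i) \<cdot>\<^sub>v unit_vec m i"
    using i nm by (intro eq_vecI) auto
  also have "V *\<^sub>v \<dots> = of_real (singular_values \<Phi> ! i) \<cdot>\<^sub>v (V *\<^sub>v unit_vec m i)"
    using V by (intro mult_mat_vec[of V m m]) auto
  also have "V *\<^sub>v unit_vec m i = col V i"
    using V i nm by (intro eq_vecI) auto
  finally show ?thesis .
qed

lemma col_unitary:
  assumes "unitary_mat n U" "i < n" "j < n"
  shows "col U i \<bullet>c col U j = (if i = j then 1 else 0)"
proof -
  have "col U i \<bullet>c col U j = (mat_adjoint U * U) $$ (j, i)"
    using assms adjoint_mult_index[of U n n U n j i] by (auto simp: unitary_mat_def)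
  then show ?thesis using assms by (auto simp: unitary_mat_def)
qed

lemma singular_values_frame_pos:
  assumes frame: "is_frame n m \<Phi>" and nm: "n \<le> m" and svd: "is_full_svd n m \<Phi> U V" and i: "i < n"
  shows "0 < singular_values \<Phi> ! i"
proof -
  have \<Phi>: "\<Phi> \<in> carrier_mat n m" using frame by (simp add: is_frame_def)
  have U: "unitary_mat n U" and V: "V \<in> carrier_mat m m"
    using svd by (auto simp: is_full_svd_def unitary_mat_def)
  have "col U i \<noteq> 0\<^sub>v n"
    using col_unitary[OF U i i] by auto
  moreover have "col U i \<in> carrier_vec n" using U i by (auto simp: unitary_mat_def)
  ultimately have "mat_adjoint \<Phi> *\<^sub>v col U i \<noteq> 0\<^sub>v m"
    using is_frame_adjoint_nonzero[OF frame] by blast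
  then have "singular_values \<Phi> ! i \<noteq> 0"
    using adjoint_mult_sigma[OF \<Phi> nm svd i] V by auto
  moreover have "0 \<le> singular_values \<Phi> ! i"
    using char_poly_gram_singular_values(2,3)[OF \<Phi> nm] i by (auto simp: in_set_conv_nth)
  ultimately show ?thesis by simp
qed

lemma full_svd_exists:
  assumes frame: "is_frame n m \<Phi>" and nm: "n \<le> m"
  shows "\<exists>U V. is_full_svd n m \<Phi> U V"
proof -
  let ?\<sigma> = "singular_values \<Phi>"
  have \<Phi>: "\<Phi> \<in> carrier_mat n m" using frame by (simp add: is_frame_def)
  note a\<Phi> = mat_adjoint_carrier[OF \<Phi>]
  note gram = char_poly_gram_singular_values[OF \<Phi> nm]
  define G where "G = \<Phi> * mat_adjoint \<Phi>"
  have G: "G \<in> carrier_mat n n" using \<Phi> a\<Phi> by (simp add: G_def)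
  have hG: "mat_adjoint G = G" unfolding G_def using mat_adjoint_mult[OF \<Phi> a\<Phi>] by simp
  have "char_poly G = (\<Prod>e\<leftarrow>map (\<lambda>t. of_real (t\<^sup>2)) ?\<sigma>. [:- e, 1:])"
    using gram(1) by (simp add: G_def comp_def)
  from hermitian_unitary_diagonalization[OF G hG this] obtain U where U: "unitary_mat n U"
    and GU: "G = U * mat_diag n (\<lambda>i. map (\<lambda>t. of_real (t\<^sup>2)) ?\<sigma> ! i) * mat_adjoint U" by blast
  define D where "D = mat_diag n (\<lambda>i. map (\<lambda>t. of_real (t\<^sup>2) :: 'a) ?\<sigma> ! i)"
  have D: "D \<in> carrier_mat n n" by (simp add: D_def)
  note Uc = unitary_mat_carrier[OF U]
  note aU = mat_adjoint_carrier[OF Uc]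
  have UU: "mat_adjoint U * U = 1\<^sub>m n" "U * mat_adjoint U = 1\<^sub>m n"
    using U by (auto simp: unitary_mat_def)
  have GUD: "G * U = U * D"
    unfolding GU D_def[symmetric] using Uc aU D
    by (simp add: assoc_mult_mat[of _ n n _ n _ n] mult_carrier_mat[of _ n n] UU)
  define w where "w i = mat_adjoint \<Phi> *\<^sub>v col U i" for i
  have w: "w i \<in> carrier_vec m" if "i < n" for i
    using that a\<Phi> Uc unfolding w_def by (intro mult_mat_vec_carrier[of _ m n]) auto
  \<comment> \<open>Moving \<open>\<Phi>\<close> across the inner product reduces this to the
    eigenvector equation for \<open>G\<close> and the orthonormality of the columns of
    \<open>U\<close>.\<close>
  have ww: "w i \<bullet>c w j = (if i = j then of_real ((?\<sigma> ! i)\<^sup>2) else 0)" if ij: "i < n" "j < n" for i j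
  proof -
    have c: "col U i \<in> carrier_vec n" "col U j \<in> carrier_vec n" using Uc ij by auto
    have "w i \<bullet>c w j = (\<Phi> *\<^sub>v w i) \<bullet>c col U j"
      using cscalar_prod_adjoint[OF \<Phi> w[OF ij(1)] c(2)] by (simp add: w_def)
    also have "\<Phi> *\<^sub>v w i = G *\<^sub>v col U i"
      unfolding w_def G_def using assoc_mult_mat_vec[OF \<Phi> a\<Phi> c(1)] by simp
    also have "\<dots> = col (G * U) i"
      using col_mult2[OF G Uc ij(1)] by simp
    also have "\<dots> = of_real ((?\<sigma> ! i)\<^sup>2) \<cdot>\<^sub>v col U i"
      unfolding GUD D_def using Uc ij gram(2)
      by (intro eq_vecI) (auto simp: mat_diag_mult_right[OF Uc] mult.commute)
    also have "\<dots> \<bullet>c col U j = of_real ((?\<sigma> ! i)\<^sup>2) * (col U i \<bullet>c col U j)"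
      using c by simp
    finally show ?thesis using col_unitary[OF U ij] by simp
  qed
  \<comment> \<open>No decomposition is available yet, so \<open>singular_values_frame_pos\<close>
    cannot be invoked; a zero value would force \<open>w i\<close> to vanish, against injectivity of
    the analysis operator.\<close>
  have pos: "?\<sigma> ! i \<noteq> 0" if i: "i < n" for i
  proof
    assume "?\<sigma> ! i = 0"
    then have "w i \<bullet>c w i = 0" using ww[OF i i] by simp
    then have "w i = 0\<^sub>v m" using conjugate_square_eq_0_vec[OF w[OF i]] by simp
    moreover have "col U i \<noteq> 0\<^sub>v n" using col_unitary[OF U i i] by auto
    moreover have "col U i \<in> carrier_vec n" using Uc i by auto
    ultimately show False using is_frame_adjoint_nonzero[OF frame] by (auto simp: w_def)
  qed
  define vs where "vs = map (\<lambda>i. of_real (1 / ?\<sigma> ! i) \<cdot>\<^sub>v w i) [0..<n]"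
  have "\<exists>V. unitary_mat m V \<and> (\<forall>i < length vs. col V i = vs ! i)"
  proof (rule orthonormal_extend_unitary)
    show "length vs \<le> m" using nm by (simp add: vs_def)
    show "set vs \<subseteq> carrier_vec m" using w by (auto simp: vs_def)
    fix i j assume "i < length vs" "j < length vs"
    then have ij: "i < n" "j < n" by (auto simp: vs_def)
    have "vs ! i \<bullet>c vs ! j = of_real (1 / ?\<sigma> ! i) * (of_real (1 / ?\<sigma> ! j) * (w i \<bullet>c w j))"
      using ij w[OF ij(1)] w[OF ij(2)]
      by (simp add: vs_def conjugate_smult_vec mult_ac del: of_real_divide)
    then show "vs ! i \<bullet>c vs ! j = (if i = j then 1 else 0)"
      using pos ij by (auto simp: ww power2_eq_square)
  qed
  then obtain V where V: "unitary_mat m V" and colV: "\<And>i. i < n \<Longrightarrow> col V i = of_real (1 / ?\<sigma> ! i) \<cdot>\<^sub>v w i"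
    by (auto simp: vs_def)
  note Vc = unitary_mat_carrier[OF V]
  define S where "S = (sigma_mat n m ?\<sigma> :: 'a mat)"
  have S: "S \<in> carrier_mat n m" by (simp add: S_def)
  note aS = mat_adjoint_carrier[OF S]
  \<comment> \<open>This is the decomposition in adjoint form; taking adjoints and multiplying by
    \<open>U\<close> from the left recovers \<open>\<Phi>\<close>.\<close>
  have "mat_adjoint \<Phi> * U = V * mat_adjoint S"
  proof (rule mat_col_eqI)
    fix i assume "i < dim_col (V * mat_adjoint S)"
    then have i: "i < n" using S by simp
    have "col (mat_adjoint \<Phi> * U) i = w i"
      unfolding w_def by (rule col_mult2[OF a\<Phi> Uc i])
    also have "\<dots> = of_real (?\<sigma> ! i) \<cdot>\<^sub>v col V i"
      using pos[OF i] by (simp add: colV[OF i] smult_smult_assoc)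
    also have "\<dots> = V *\<^sub>v (of_real (?\<sigma> ! i) \<cdot>\<^sub>v unit_vec m i)"
      using Vc i nm by (intro eq_vecI) (auto simp: mult.commute)
    also have "of_real (?\<sigma> ! i) \<cdot>\<^sub>v unit_vec m i = col (mat_adjoint S) i"
      using i nm by (intro eq_vecI) (auto simp: S_def)
    also have "V *\<^sub>v \<dots> = col (V * mat_adjoint S) i"
      using col_mult2[OF Vc aS i] by simp
    finally show "col (mat_adjoint \<Phi> * U) i = col (V * mat_adjoint S) i" .
  qed (use \<Phi> Uc Vc S in auto)
  then have "mat_adjoint (mat_adjoint \<Phi> * U) = mat_adjoint (V * mat_adjoint S)" by simp
  then have "mat_adjoint U * \<Phi> = S * mat_adjoint V"
    by (simp add: mat_adjoint_mult[OF a\<Phi> Uc] mat_adjoint_mult[OF Vc aS])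
  then have "U * (mat_adjoint U * \<Phi>) = U * S * mat_adjoint V"
    using assoc_mult_mat[OF Uc S mat_adjoint_carrier[OF Vc]] by simp
  then have "\<Phi> = U * S * mat_adjoint V"
    using assoc_mult_mat[OF Uc aU \<Phi>] UU \<Phi> by simp
  then show ?thesis using U V unfolding is_full_svd_def S_def by blast
qed

section \<open>Duals from orthogonal families\<close>

lemma sum_split_shift:
  fixes f :: "nat \<Rightarrow> 'b::comm_monoid_add"
  assumes "n \<le> m"
  shows "(\<Sum>c=0..<m. f c) = (\<Sum>c=0..<n. f c) + (\<Sum>c=0..<m - n. f (n + c))"
proof -
  have "(\<Sum>c=0..<m. f c) = (\<Sum>c=0..<n. f c) + (\<Sum>c=n..<m. f c)"
    using assms by (simp add: sum.atLeastLessThan_concat)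
  also have "(\<Sum>c=n..<m. f c) = (\<Sum>c=0..<m - n. f (n + c))"
    using sum.atLeastLessThan_shift_0[of f n m] by (simp add: add.commute)
  finally show ?thesis .
qed

text \<open>Each inner product of rows splits at column \<open>n\<close>: the diagonal block gives
  the reciprocal squares, the remaining columns the inner product of the free vectors.\<close>

lemma dual_core_gram_index:
  assumes nm: "n \<le> m" and s: "s i \<in> carrier_vec (m - n)" "s j \<in> carrier_vec (m - n)"
    and ij: "i < n" "j < n"
  shows "(dual_core n m \<sigma> s * mat_adjoint (dual_core n m \<sigma> s)) $$ (i, j)
    = (if i = j then of_real ((1 / \<sigma> ! i)\<^sup>2) else 0) + s i \<bullet>c s j"
proof -
  let ?M = "dual_core n m \<sigma> s"
  have M: "?M \<in> carrier_mat n m" by (simp add: dual_core_def)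
  have "(?M * mat_adjoint ?M) $$ (i, j) = (\<Sum>c=0..<m. ?M $$ (i, c) * conjugate (?M $$ (j, c)))"
    using M ij by (simp add: scalar_prod_def)
  also have "\<dots> = (\<Sum>c=0..<n. ?M $$ (i, c) * conjugate (?M $$ (j, c)))
      + (\<Sum>c=0..<m - n. ?M $$ (i, n + c) * conjugate (?M $$ (j, n + c)))"
    by (rule sum_split_shift[OF nm])
  also have "(\<Sum>c=0..<n. ?M $$ (i, c) * conjugate (?M $$ (j, c)))
      = (\<Sum>c=0..<n. if c = i then (if i = j then of_real ((1 / \<sigma> ! i)\<^sup>2) else 0) else 0)"
    using ij nm by (intro sum.cong refl)
      (auto simp: dual_core_def power2_eq_square simp flip: of_real_mult simp del: of_real_divide)
  also have "\<dots> = (if i = j then of_real ((1 / \<sigma> ! i)\<^sup>2) else 0)"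
    using ij by (simp add: sum.delta)
  also have "(\<Sum>c=0..<m - n. ?M $$ (i, n + c) * conjugate (?M $$ (j, n + c))) = s i \<bullet>c s j"
    using s ij nm by (auto simp: dual_core_def scalar_prod_def intro!: sum.cong)
  finally show ?thesis .
qed

section \<open>Properties and existence of the orthogonalized family\<close>

text \<open>Gram-Schmidt returns nonzero orthogonal vectors, and rescaling keeps them orthogonal.
  The absolute value arises because nothing here bounds \<open>q\<close> from below and
  \<open>sqrt\<close> is odd on the reals.\<close>

lemma orthogonalized_family_props:
  fixes s :: "nat \<Rightarrow> 'a::real_or_complex vec"
  assumes fam: "orthogonalized_family k \<sigma> q I s"
  shows "s i \<in> carrier_vec k"
    and "i \<in> I \<Longrightarrow> j \<in> I \<Longrightarrow> i \<noteq> j \<Longrightarrow> s i \<bullet>c s j = 0"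
    and "i \<in> I \<Longrightarrow> (l2_norm (s i))\<^sup>2 = \<bar>(q i)\<^sup>2 - 1 / (\<sigma> ! i)\<^sup>2\<bar>"
    and "i \<notin> I \<Longrightarrow> s i = 0\<^sub>v k"
proof -
  obtain js ws where js: "set js = I" "length ws = length js"
    and ws: "set ws \<subseteq> carrier_vec k" "distinct ws"
      "\<not> module.lin_dep class_ring (module_vec TYPE('a) k) (set ws)"
    and s: "\<And>l. l < length js \<Longrightarrow> s (js ! l) =
      of_real (sqrt ((q (js ! l))\<^sup>2 - 1 / (\<sigma> ! (js ! l))\<^sup>2) / l2_norm (gram_schmidt k ws ! l))
        \<cdot>\<^sub>v gram_schmidt k ws ! l"
    and s0: "\<And>i. i \<notin> I \<Longrightarrow> s i = 0\<^sub>v k"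
    using fam unfolding orthogonalized_family_def Let_def by blast
  interpret cof_vec_space k "TYPE('a)" .
  define us where "us = gram_schmidt k ws"
  note gs = gram_schmidt_result[OF ws us_def]
  \<comment> \<open>The equivalence also covers equal indices, where it says that the vectors are
    nonzero and may be normalized.\<close>
  have us: "us ! l \<in> carrier_vec k" "us ! l \<bullet>c us ! l' = 0 \<longleftrightarrow> l \<noteq> l'"
    if "l < length js" "l' < length js" for l l'
    using that gs(2-4) js(2) corthogonalD[OF gs(2)] by auto
  show "i \<notin> I \<Longrightarrow> s i = 0\<^sub>v k" by (rule s0)
  show "s i \<in> carrier_vec k"
  proof (cases "i \<in> I")
    case True
    then obtain l where "l < length js" "i = js ! l" using js by (auto simp: in_set_conv_nth)
    then show ?thesis using s us(1) by (auto simp: us_def[symmetric])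
  qed (simp add: s0)
  show "s i \<bullet>c s j = 0" if ij: "i \<in> I" "j \<in> I" "i \<noteq> j"
  proof -
    obtain l l' where l: "l < length js" "i = js ! l" "l' < length js" "j = js ! l'"
      using js ij by (metis in_set_conv_nth)
    then have "us ! l \<bullet>c us ! l' = 0" using us(2) ij by auto
    then show ?thesis
      using l us(1)[of l l'] us(1)[of l' l] by (simp add: s us_def[symmetric] conjugate_smult_vec)
  qed
  show "(l2_norm (s i))\<^sup>2 = \<bar>(q i)\<^sup>2 - 1 / (\<sigma> ! i)\<^sup>2\<bar>" if i: "i \<in> I"
  proof -
    obtain l where l: "l < length js" "i = js ! l" using js i by (auto simp: in_set_conv_nth)
    have "us ! l \<bullet>c us ! l \<noteq> 0" using us(2)[OF l(1) l(1)] by simp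
    then have "l2_norm (us ! l) \<noteq> 0" by (auto simp: cscalar_prod_self)
    then have "l2_norm (s i) = \<bar>sqrt ((q i)\<^sup>2 - 1 / (\<sigma> ! i)\<^sup>2)\<bar>"
      using l by (simp add: s us_def[symmetric] l2_norm_smult del: of_real_divide)
    then show ?thesis by (simp flip: real_sqrt_power)
  qed
qed

text \<open>The first \<open>card I\<close> standard unit vectors serve as starting vectors;
  \<open>card I \<le> k\<close> makes them available and independent.\<close>

lemma orthogonalized_family_exists:
  assumes I: "finite I" "card I \<le> k"
  shows "\<exists>s. orthogonalized_family k \<sigma> q I (s :: nat \<Rightarrow> 'a::real_or_complex vec)"
proof -
  interpret cof_vec_space k "TYPE('a)" .
  define js where "js = sorted_list_of_set I"
  have js: "distinct js" "set js = I" "length js = card I" using I by (auto simp: js_def)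
  define ws :: "'a vec list" where "ws = map (unit_vec k) [0..<card I]"
  have ws: "length ws = length js" "set ws \<subseteq> carrier_vec k"
    using js by (auto simp: ws_def)
  have "distinct ws"
    using I by (auto simp: ws_def distinct_map inj_on_def)
  have "\<not> lin_dep (set (unit_vecs k))"
    using unit_vecs_basis by (simp add: basis_def)
  moreover have "set ws \<subseteq> set (unit_vecs k)" using I by (auto simp: ws_def unit_vecs_def)
  ultimately have ind: "\<not> lin_dep (set ws)" using subset_li_is_li by blast
  \<comment> \<open>The choice recovers the position of \<open>i\<close> in \<open>js\<close>, which
    is unique since \<open>js\<close> is distinct.\<close>
  define u where "u i = gram_schmidt k ws ! (SOME l. l < length js \<and> js ! l = i)" for i
  define s where "s i = (if i \<in> I
    then of_real (sqrt ((q i)\<^sup>2 - 1 / (\<sigma> ! i)\<^sup>2) / l2_norm (u i)) \<cdot>\<^sub>v u i else 0\<^sub>v k)" for i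
  have "u (js ! l) = gram_schmidt k ws ! l" if "l < length js" for l
  proof -
    have "(SOME l'. l' < length js \<and> js ! l' = js ! l) = l"
      using that js(1) by (intro some_equality) (auto simp: nth_eq_iff_index_eq)
    then show ?thesis by (simp add: u_def)
  qed
  then have "orthogonalized_family k \<sigma> q I s"
    unfolding orthogonalized_family_def Let_def
    using js ws ind \<open>distinct ws\<close>
    by (intro exI[of _ js] exI[of _ ws]) (auto simp: s_def)
  then show ?thesis by blast
qed

section \<open>Duality and spectrum of the constructed matrix\<close>

text \<open>The unitary \<open>V\<close> cancels in the middle. With \<Sigma> as second factor this
  yields duality; with equal factors it yields the Gram matrix of the dual.\<close>

lemma unitary_sandwich:
  assumes "unitary_mat m V" "U \<in> carrier_mat n n" "A \<in> carrier_mat n m" "B \<in> carrier_mat n m"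
  shows "(U * A * mat_adjoint V) * mat_adjoint (U * B * mat_adjoint V)
    = U * (A * mat_adjoint B) * mat_adjoint U"
proof -
  have V: "V \<in> carrier_mat m m" "mat_adjoint V * V = 1\<^sub>m m" using assms by (auto simp: unitary_mat_def)
  have UA: "U * A \<in> carrier_mat n m" and UB: "U * B \<in> carrier_mat n m" using assms by auto
  note aV = mat_adjoint_carrier[OF V(1)] and aU = mat_adjoint_carrier[OF assms(2)]
    and aB = mat_adjoint_carrier[OF assms(4)] and aUB = mat_adjoint_carrier[OF UB]
  have "(U * A * mat_adjoint V) * mat_adjoint (U * B * mat_adjoint V)
    = (U * A * mat_adjoint V) * (V * mat_adjoint (U * B))"
    using mat_adjoint_mult[OF UB aV] by simp
  also have "\<dots> = (U * A) * (mat_adjoint V * (V * mat_adjoint (U * B)))"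
    by (rule assoc_mult_mat[OF UA aV mult_carrier_mat[OF V(1) aUB]])
  also have "mat_adjoint V * (V * mat_adjoint (U * B)) = mat_adjoint (U * B)"
    using assoc_mult_mat[OF aV V(1) aUB] V(2) left_mult_one_mat[OF aUB] by simp
  also have "\<dots> = mat_adjoint B * mat_adjoint U" by (rule mat_adjoint_mult[OF assms(2,4)])
  also have "U * A * (mat_adjoint B * mat_adjoint U) = U * (A * mat_adjoint B) * mat_adjoint U"
    using assoc_mult_mat[OF UA aB aU] assoc_mult_mat[OF assms(2,3) aB] by simp
  finally show ?thesis .
qed

text \<open>The vectors \<open>s i\<close> meet only zero columns of \<Sigma>, and
  \<open>1 / \<sigma> ! i\<close> cancels the diagonal entry, so the core times the adjoint of
  \<Sigma> is the identity for every choice of \<open>s\<close>.\<close>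

lemma dual_core_is_dual_frame:
  assumes frame: "is_frame n m \<Phi>" and nm: "n \<le> m" and svd: "is_full_svd n m \<Phi> U V"
  shows "is_dual_frame n m \<Phi> (U * dual_core n m (singular_values \<Phi>) s * mat_adjoint V)"
proof (rule is_dual_frameI)
  let ?M = "dual_core n m (singular_values \<Phi>) s :: 'a mat"
    and ?S = "sigma_mat n m (singular_values \<Phi>) :: 'a mat"
  have M: "?M \<in> carrier_mat n m" by (simp add: dual_core_def)
  have S: "?S \<in> carrier_mat n m" by simp
  have U: "unitary_mat n U" and V: "unitary_mat m V" and eq: "\<Phi> = U * ?S * mat_adjoint V"
    using svd by (auto simp: is_full_svd_def)
  note Uc = unitary_mat_carrier[OF U] and Vc = unitary_mat_carrier[OF V]
  show \<Phi>: "\<Phi> \<in> carrier_mat n m" using frame by (simp add: is_frame_def)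
  show "U * ?M * mat_adjoint V \<in> carrier_mat n m"
    by (rule mult_carrier_mat[OF mult_carrier_mat[OF Uc M] mat_adjoint_carrier[OF Vc]])
  have "?M * mat_adjoint ?S = 1\<^sub>m n"
  proof (rule eq_matI)
    fix i j assume "i < dim_row (1\<^sub>m n :: 'a mat)" "j < dim_col (1\<^sub>m n :: 'a mat)"
    then have ij: "i < n" "j < n" by auto
    have pos: "singular_values \<Phi> ! i \<noteq> 0"
      using singular_values_frame_pos[OF frame nm svd ij(1)] by simp
    have "(?M * mat_adjoint ?S) $$ (i, j) = (\<Sum>c=0..<m. ?M $$ (i, c) * conjugate (?S $$ (j, c)))"
      using M S ij by (simp add: scalar_prod_def)
    also have "\<dots> = (\<Sum>c=0..<m. if c = j then (if i = j then 1 else 0) else 0)"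
      using ij nm pos by (intro sum.cong refl) (auto simp: dual_core_def)
    also have "\<dots> = 1\<^sub>m n $$ (i, j)" using ij nm by (simp add: sum.delta)
    finally show "(?M * mat_adjoint ?S) $$ (i, j) = 1\<^sub>m n $$ (i, j)" .
  qed (auto simp: dual_core_def)
  then have "(U * ?M * mat_adjoint V) * mat_adjoint (U * ?S * mat_adjoint V) = 1\<^sub>m n"
    using unitary_sandwich[OF V Uc M S] U
    by (simp add: unitary_mat_def right_mult_one_mat[OF Uc])
  then show "U * ?M * mat_adjoint V * mat_adjoint \<Phi> = 1\<^sub>m n" using eq by simp
qed

text \<open>Orthogonality makes the Gram matrix of the core diagonal, so the Gram matrix of the
  product is unitarily similar to that diagonal matrix. Multisets are compared because the diagonal
  need not be sorted.\<close>

lemma dual_core_singular_values: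
  assumes nm: "n \<le> m" and U: "unitary_mat n U" and V: "unitary_mat m V"
    and s: "\<And>i. i < n \<Longrightarrow> s i \<in> carrier_vec (m - n)"
    and orth: "\<And>i j. i < n \<Longrightarrow> j < n \<Longrightarrow> i \<noteq> j \<Longrightarrow> s i \<bullet>c s j = 0"
  shows "mset (singular_values (U * dual_core n m \<sigma> s * mat_adjoint V))
    = image_mset (\<lambda>i. sqrt ((1 / \<sigma> ! i)\<^sup>2 + (l2_norm (s i))\<^sup>2)) (mset_set {..<n})"
proof -
  let ?M = "dual_core n m \<sigma> s :: 'a mat"
  let ?\<Psi> = "U * ?M * mat_adjoint V"
  define d where "d i = (1 / \<sigma> ! i)\<^sup>2 + (l2_norm (s i))\<^sup>2" for i
  have M: "?M \<in> carrier_mat n m" by (simp add: dual_core_def)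
  have MM: "?M * mat_adjoint ?M = mat_diag n (\<lambda>i. of_real (d i))"
  proof (rule eq_matI)
    fix i j assume "i < dim_row (mat_diag n (\<lambda>i. of_real (d i) :: 'a))"
      "j < dim_col (mat_diag n (\<lambda>i. of_real (d i) :: 'a))"
    then have ij: "i < n" "j < n" by (auto simp: mat_diag_def)
    show "(?M * mat_adjoint ?M) $$ (i, j) = mat_diag n (\<lambda>i. of_real (d i)) $$ (i, j)"
      using dual_core_gram_index[where \<sigma>=\<sigma>, OF nm s[OF ij(1)] s[OF ij(2)] ij] orth[OF ij] ij
      by (auto simp: mat_diag_def d_def cscalar_prod_self)
  qed (auto simp: dual_core_def mat_diag_def)
  note Uc = unitary_mat_carrier[OF U]
  have G: "?\<Psi> * mat_adjoint ?\<Psi> = U * mat_diag n (\<lambda>i. of_real (d i)) * mat_adjoint U"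
    using unitary_sandwich[OF V Uc M M] by (simp add: MM)
  have "char_poly (?\<Psi> * mat_adjoint ?\<Psi>) = (\<Prod>i\<leftarrow>[0..<n]. [:- of_real (d i), 1:])"
    unfolding G by (simp add: char_poly_unitary_conj[OF U] char_poly_mat_diag)
  also have "proots \<dots> = (\<Sum>p\<leftarrow>map (\<lambda>i. [:- of_real (d i), 1:]) [0..<n]. proots p)"
    by (subst proots_prod_list[symmetric]) auto
  also have "\<dots> = image_mset (\<lambda>i. of_real (d i)) (mset [0..<n])"
  proof -
    have "(\<Sum>p\<leftarrow>map (\<lambda>i. [:- of_real (d i) :: 'a, 1:]) is. proots p)
      = image_mset (\<lambda>i. of_real (d i)) (mset is)" for "is"
      by (induction "is") auto
    then show ?thesis .
  qed
  finally have roots: "proots (char_poly (?\<Psi> * mat_adjoint ?\<Psi>))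
    = image_mset (\<lambda>i. of_real (d i)) (mset_set {..<n})"
    by (simp add: atLeast0LessThan)
  have "dim_row ?\<Psi> \<le> dim_col ?\<Psi>" using Uc unitary_mat_carrier[OF V] nm by simp
  moreover have "0 \<le> d i" for i by (simp add: d_def)
  ultimately have "mset (singular_values ?\<Psi>) = image_mset (\<lambda>i. sqrt (d i)) (mset_set {..<n})"
    by (simp add: singular_values_def roots multiset.map_comp comp_def)
  then show ?thesis by (simp add: d_def)
qed

text \<open>The second conjunct expresses constructivity: every full decomposition combined with
  every output of the orthogonalization gives a suitable dual. Containment is between multisets, so
  repeated values of \<open>q\<close> are counted, and \<open>n + r \<le> m\<close> avoids truncated
  subtraction.\<close>

theorem theorem4p2:
  fixes \<Phi> :: "'a::real_or_complex mat" and n m r :: nat and I :: "nat set" and q :: "nat \<Rightarrow> real"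
  assumes frame: "is_frame n m \<Phi>"
    and r: "n + r \<le> m"
    and I: "I \<subseteq> {..<n}" "card I = r"
    and q: "\<And>i. i \<in> I \<Longrightarrow> 1 / singular_values \<Phi> ! i \<le> q i"
  shows
    "(\<exists>\<Psi>. is_dual_frame n m \<Phi> \<Psi> \<and>
           image_mset q (mset_set I) \<subseteq># mset (singular_values \<Psi>) \<and>
           (\<exists>U V s. is_full_svd n m \<Phi> U V \<and>
                    orthogonalized_family (m - n) (singular_values \<Phi>) q I s \<and>
                    \<Psi> = U * dual_core n m (singular_values \<Phi>) s * mat_adjoint V)) \<and>
     (\<forall>U V s. is_full_svd n m \<Phi> U V \<and>
              orthogonalized_family (m - n) (singular_values \<Phi>) q I s \<longrightarrow>
        (\<forall>i\<in>I. \<forall>j\<in>I. i \<noteq> j \<longrightarrow> s i \<bullet>c s j = 0) \<and>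
        (\<forall>i\<in>I. (q i)\<^sup>2 = 1 / (singular_values \<Phi> ! i)\<^sup>2 + (l2_norm (s i))\<^sup>2) \<and>
        (\<forall>i<n. i \<notin> I \<longrightarrow> s i = 0\<^sub>v (m - n)) \<and>
        is_dual_frame n m \<Phi> (U * dual_core n m (singular_values \<Phi>) s * mat_adjoint V) \<and>
        image_mset q (mset_set I) \<subseteq>#
          mset (singular_values (U * dual_core n m (singular_values \<Phi>) s * mat_adjoint V)))"
    (is "?ex \<and> (\<forall>U V s. ?fam U V s \<longrightarrow> ?good U V s)")
proof -
  let ?\<sigma> = "singular_values \<Phi>"
  have nm: "n \<le> m" using r by simp
  \<comment> \<open>The universal part comes first; existence then only needs one decomposition and
    one family.\<close>
  have good: "?good U V s" if fam: "?fam U V s" for U V s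
  proof -
    have svd: "is_full_svd n m \<Phi> U V" using fam by simp
    note props = orthogonalized_family_props[OF conjunct2[OF fam]]
    have q0: "0 < 1 / ?\<sigma> ! i" "1 / ?\<sigma> ! i \<le> q i" if "i \<in> I" for i
      using singular_values_frame_pos[OF frame nm svd] I that q by auto
    have norm: "(q i)\<^sup>2 = 1 / (?\<sigma> ! i)\<^sup>2 + (l2_norm (s i))\<^sup>2" if i: "i \<in> I" for i
    proof -
      \<comment> \<open>The lower bound on \<open>q i\<close>, whose left side is positive, removes
        the absolute value from the norm formula.\<close>
      have "(1 / ?\<sigma> ! i)\<^sup>2 \<le> (q i)\<^sup>2" using q0[OF i] by (intro power_mono) auto
      then show ?thesis using props(3)[OF i] by (simp add: power_divide)
    qed
    \<comment> \<open>Orthogonality extends beyond \<open>I\<close> because the other vectors are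
      zero.\<close>
    have orth: "s i \<bullet>c s j = 0" if "i \<noteq> j" for i j
    proof (cases "i \<in> I \<and> j \<in> I")
      case False
      then have "s i = 0\<^sub>v (m - n) \<or> s j = 0\<^sub>v (m - n)" using props(4) by auto
      then show ?thesis using props(1)[of i] props(1)[of j] by auto
    qed (use props(2) that in auto)
    have "unitary_mat n U" "unitary_mat m V" using svd by (auto simp: is_full_svd_def)
    then have sv: "mset (singular_values (U * dual_core n m ?\<sigma> s * mat_adjoint V))
      = image_mset (\<lambda>i. sqrt ((1 / ?\<sigma> ! i)\<^sup>2 + (l2_norm (s i))\<^sup>2)) (mset_set {..<n})"
      by (rule dual_core_singular_values[OF nm]) (use props(1) orth in auto)
    have "finite I" using I(1) finite_subset by blast
    then have "image_mset q (mset_set I)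
      = image_mset (\<lambda>i. sqrt ((1 / ?\<sigma> ! i)\<^sup>2 + (l2_norm (s i))\<^sup>2)) (mset_set I)"
    proof (intro image_mset_cong)
      fix i assume "i \<in># mset_set I"
      then have i: "i \<in> I" using \<open>finite I\<close> by simp
      have "0 \<le> q i" using q0[OF i] by linarith
      then have "sqrt ((q i)\<^sup>2) = q i" by simp
      then show "q i = sqrt ((1 / ?\<sigma> ! i)\<^sup>2 + (l2_norm (s i))\<^sup>2)"
        unfolding norm[OF i] by (simp add: power_divide)
    qed
    \<comment> \<open>The prescribed values are those of the full spectrum at the indices in
      \<open>I\<close>, a subset of \<open>{..<n}\<close>.\<close>
    also have "\<dots> \<subseteq># mset (singular_values (U * dual_core n m ?\<sigma> s * mat_adjoint V))"
      unfolding sv using I(1) by (intro image_mset_subseteq_mono subset_imp_msubset_mset_set) auto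
    finally show ?thesis
      using props norm dual_core_is_dual_frame[OF frame nm svd] by blast
  qed
  obtain U V where svd: "is_full_svd n m \<Phi> U V" using full_svd_exists[OF frame nm] by blast
  have "finite I" using I(1) finite_subset by blast
  then obtain s :: "nat \<Rightarrow> 'a vec" where "orthogonalized_family (m - n) ?\<sigma> q I s"
    using orthogonalized_family_exists[of I "m - n"] I r by fastforce
  with svd have "?fam U V s" by simp
  then have ?ex using good by blast
  then show ?thesis using good by blast
qed

end
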